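(* If $T$ is a tree all of whose nodes are finite, then each of the following conditions implies that $T$ is reversible: (i) $\mathrm{ht}(T)\leq\omega+1$; (ii) for each ordinal $\alpha\in[\omega,\mathrm{ht}(T))$, the sequence $\langle |N| : N\in\mathcal{N}(T),\ N\subset L_\alpha\rangle$ is almost constant or the sequence $\langle\langle |N|,|N\uparrow|\rangle : N\in\mathcal{N}(T),\ N\subset L_\alpha\rangle$ is finite-to-one.
   Context: A tree is a strict partial order $\langle T,<\rangle$ such that for each $t\in T$ the set $(\cdot,t):=\{s\in T:s<t\}$ is well-ordered or empty. The height of $t$ is the order type of $(\cdot,t)$; $L_\alpha$ is the set of elements of height $\alpha$; the height $\mathrm{ht}(T)$ of $T$ is the least ordinal $\alpha$ with $L_\alpha=\emptyset$. The nodes of $T$ are the equivalence classes of the relation $s\sim t \Leftrightarrow (\cdot,s)=(\cdot,t)$ (each node is contained in a single level); $\mathcal{N}(T)$ is the set of nodes. For $S\subset T$, $S\uparrow:=\{t\in T:\exists s\in S\; t\geq s\}$. A tree is reversible iff every condensation of $T$, i.e. every bijection $f:T\to T$ such that $x<y$ implies $f(x)<f(y)$, is an automorphism of $T$. A sequence (indexed family) $\langle x_j:j\in J\rangle$ is almost constant iff there is a value $x$ such that $\{j\in J:x_j\neq x\}$ is finite; it is finite-to-one iff each value is taken for only finitely many indices $j$. *)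

theory Defs
  imports Main "HOL-Library.Equipollence"
begin

unbundle cardinal_syntax

text \<open>
  A tree is given by its carrier \<open>T\<close> and its strict order \<open>lt\<close>, with \<open>(x, y) \<in> lt\<close> read
  as \<open>x < y\<close>.  The well-order predicates of the library are stated for reflexive relations,
  hence the reflexive closures below.
\<close>

definition preds :: "'a rel \<Rightarrow> 'a \<Rightarrow> 'a set" where
  "preds lt t = {s. (s, t) \<in> lt}"

definition pred_order :: "'a rel \<Rightarrow> 'a \<Rightarrow> 'a rel" where
  "pred_order lt t = Restr (lt\<^sup>=) (preds lt t)"

text \<open>The empty relation is a well-order of the empty set.\<close>

definition tree :: "'a set \<Rightarrow> 'a rel \<Rightarrow> bool" where
  "tree T lt \<longleftrightarrow> lt \<subseteq> T \<times> T \<and> irrefl lt \<and> trans lt \<and>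
     (\<forall>t\<in>T. well_order_on (preds lt t) (pred_order lt t))"

text \<open>
  Ordinals are represented by well-orders \<open>r\<close> (with \<open>Well_order r\<close>), on any type, up to
  \<open>=o\<close> and compared by \<open>\<le>o\<close> and \<open><o\<close>; \<open>natLeq\<close> represents \<open>\<omega>\<close>.
\<close>

definition level :: "'a set \<Rightarrow> 'a rel \<Rightarrow> 'b rel \<Rightarrow> 'a set" where
  "level T lt r = {t \<in> T. pred_order lt t =o r}"

definition is_height :: "'a set \<Rightarrow> 'a rel \<Rightarrow> 'a rel \<Rightarrow> bool" where
  "is_height T lt r \<longleftrightarrow> Well_order r \<and> level T lt r = {} \<and>
     (\<forall>r' :: 'a rel. Well_order r' \<and> level T lt r' = {} \<longrightarrow> r \<le>o r')"

definition height :: "'a set \<Rightarrow> 'a rel \<Rightarrow> 'a rel" where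
  "height T lt = (SOME r. is_height T lt r)"

text \<open>The successor of an ordinal: one new element \<open>None\<close> on top.\<close>

definition ord_succ :: "'a rel \<Rightarrow> 'a option rel" where
  "ord_succ r = {(Some x, Some y) |x y. (x, y) \<in> r} \<union> {(Some x, None) |x. x \<in> Field r} \<union> {(None, None)}"

lemma Well_order_ord_succ:
  assumes "Well_order r"
  shows "Well_order (ord_succ r)"
proof -
  have wr: "wo_rel r" using assms by (simp add: wo_rel_def)
  have F: "Field (ord_succ r) = insert None (Some ` Field r)"
    by (auto simp: ord_succ_def Field_def)
  have "refl_on (Field (ord_succ r)) (ord_succ r)"
    unfolding F using wo_rel.REFL[OF wr] by (auto simp: refl_on_def ord_succ_def)
  moreover have "trans (ord_succ r)"
    using wo_rel.TRANS[OF wr] unfolding trans_def ord_succ_def by (auto intro: FieldI1)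
  moreover have "antisym (ord_succ r)"
    using wo_rel.ANTISYM[OF wr] by (auto simp: antisym_def ord_succ_def)
  moreover have "total_on (Field (ord_succ r)) (ord_succ r)"
    unfolding F using wo_rel.TOTAL[OF wr] by (auto simp: total_on_def ord_succ_def)
  moreover have "wf (ord_succ r - Id)"
  proof -
    have wf: "wf (r - Id)" using wo_rel.WELL[OF wr] by (simp add: well_order_on_def)
    show ?thesis
      unfolding wf_def
    proof (intro allI impI)
      fix P x assume P: "\<forall>x. (\<forall>y. (y, x) \<in> ord_succ r - Id \<longrightarrow> P y) \<longrightarrow> P x"
      have S: "P (Some a)" for a
      proof (induct a rule: wf_induct_rule[OF wf])
        case (1 a)
        have "P y" if "(y, Some a) \<in> ord_succ r - Id" for y
          using that 1 by (auto simp: ord_succ_def)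
        then show "P (Some a)" using P by blast
      qed
      moreover have "P None"
      proof -
        have "P y" if "(y, None) \<in> ord_succ r - Id" for y
          using that S by (auto simp: ord_succ_def)
        then show ?thesis using P by blast
      qed
      ultimately show "P x" by (cases x) auto
    qed
  qed
  ultimately show ?thesis
    unfolding well_order_on_def linear_order_on_def partial_order_on_def preorder_on_def
    by (auto intro: FieldI1 FieldI2)
qed

definition nodes :: "'a set \<Rightarrow> 'a rel \<Rightarrow> 'a set set" where
  "nodes T lt = T // {(s, t) \<in> T \<times> T. preds lt s = preds lt t}"

definition level_nodes :: "'a set \<Rightarrow> 'a rel \<Rightarrow> 'b rel \<Rightarrow> 'a set set" where
  "level_nodes T lt r = {N \<in> nodes T lt. N \<subseteq> level T lt r}"

definition upset :: "'a set \<Rightarrow> 'a rel \<Rightarrow> 'a set \<Rightarrow> 'a set" where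
  "upset T lt S = {t \<in> T. \<exists>s\<in>S. (s, t) \<in> lt\<^sup>=}"

definition condensation :: "'a set \<Rightarrow> 'a rel \<Rightarrow> ('a \<Rightarrow> 'a) \<Rightarrow> bool" where
  "condensation T lt f \<longleftrightarrow> bij_betw f T T \<and>
     (\<forall>x\<in>T. \<forall>y\<in>T. (x, y) \<in> lt \<longrightarrow> (f x, f y) \<in> lt)"

definition automorphism :: "'a set \<Rightarrow> 'a rel \<Rightarrow> ('a \<Rightarrow> 'a) \<Rightarrow> bool" where
  "automorphism T lt f \<longleftrightarrow> bij_betw f T T \<and>
     (\<forall>x\<in>T. \<forall>y\<in>T. (x, y) \<in> lt \<longleftrightarrow> (f x, f y) \<in> lt)"

definition reversible :: "'a set \<Rightarrow> 'a rel \<Rightarrow> bool" where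
  "reversible T lt \<longleftrightarrow> (\<forall>f. condensation T lt f \<longrightarrow> automorphism T lt f)"

definition almost_constant :: "('i \<Rightarrow> 'b) \<Rightarrow> 'i set \<Rightarrow> bool" where
  "almost_constant x J \<longleftrightarrow> (\<exists>c. finite {j \<in> J. x j \<noteq> c})"

definition finite_to_one :: "('i \<Rightarrow> 'b) \<Rightarrow> 'i set \<Rightarrow> bool" where
  "finite_to_one x J \<longleftrightarrow> (\<forall>c. finite {j \<in> J. x j = c})"

text \<open>
  The sets \<open>N\<up>\<close> may be infinite of different cardinalities, so \<open>card\<close> is not adequate for
  them.  The cardinal of \<open>A\<close> is the class of all sets (over the same type) equipollent to
  \<open>A\<close>, so that equal cardinals are equal values.
\<close>

definition cardinal :: "'a set \<Rightarrow> 'a set set" where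
  "cardinal A = {B. B \<approx> A}"

text \<open>
  The height exists as a well-order on the type of the tree itself, and it is the least ordinal
  with empty level among well-orders on all types.
\<close>

lemma Well_order_pred_order:
  assumes "tree T lt" "t \<in> T"
  shows "Well_order (pred_order lt t)" "Field (pred_order lt t) = preds lt t"
proof -
  have w: "well_order_on (preds lt t) (pred_order lt t)"
    using assms unfolding tree_def by blast
  show f: "Field (pred_order lt t) = preds lt t"
    using well_order_on_Field[OF w] by simp
  show "Well_order (pred_order lt t)"
    using w f by simp
qed

lemma pred_order_initial:
  assumes T: "tree T lt" and pt: "(p, t) \<in> lt"
  shows "Restr (pred_order lt t) (underS (pred_order lt t) p) = pred_order lt p"
proof -
  have irr: "\<And>x. (x, x) \<notin> lt" and tr: "trans lt"
    using T unfolding tree_def irrefl_def by blast+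
  have "underS (pred_order lt t) p = preds lt p"
    using irr pt transD[OF tr] by (auto simp: underS_def pred_order_def preds_def)
  then show ?thesis
    using pt transD[OF tr] by (auto simp: pred_order_def preds_def)
qed

lemma ex_Well_order_empty_level:
  fixes T :: "'a set"
  assumes T: "tree T lt"
  shows "\<exists>r :: 'a rel. Well_order r \<and> level T lt r = {}"
proof -
  define p where "p = pred_order lt"
  define rep where "rep t = (SOME s. s \<in> T \<and> p s =o p t)" for t
  have wo: "Well_order (p t)" if "t \<in> T" for t
    using Well_order_pred_order[OF T that] by (simp add: p_def)
  have rep: "rep t \<in> T" "p (rep t) =o p t" if "t \<in> T" for t
  proof -
    have "t \<in> T \<and> p t =o p t" using that wo ordIso_reflexive by blast
    then have "rep t \<in> T \<and> p (rep t) =o p t"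
      unfolding rep_def by (rule someI)
    then show "rep t \<in> T" "p (rep t) =o p t" by auto
  qed
  have rep_eq: "rep s = rep t" if "p s =o p t" for s t
  proof -
    have "(u \<in> T \<and> p u =o p s) = (u \<in> T \<and> p u =o p t)" for u
      using ordIso_transitive[OF _ that] ordIso_transitive[OF _ ordIso_symmetric[OF that]] by auto
    then show ?thesis unfolding rep_def by simp
  qed
  define R where "R = rep ` T"
  have RT: "R \<subseteq> T" using rep by (auto simp: R_def)
  have R_eq: "s = t" if "s \<in> R" "t \<in> R" "p s =o p t" for s t
  proof -
    have "rep u = u" if "u \<in> R" for u
    proof -
      from that obtain v where v: "v \<in> T" "u = rep v" unfolding R_def by blast
      then show ?thesis using rep_eq[OF rep(2)[OF v(1)]] by simp
    qed
    then show ?thesis using rep_eq[OF that(3)] that(1,2) by simp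
  qed
  define q where "q = {(s, t) \<in> R \<times> R. p s \<le>o p t}"
  have "refl_on R q"
    using RT wo ordLeq_reflexive by (auto simp: refl_on_def q_def)
  moreover have "trans q"
    by (auto simp: trans_def q_def intro: ordLeq_transitive)
  moreover have "antisym q"
    by (auto simp: antisym_def q_def ordIso_iff_ordLeq intro!: R_eq)
  moreover have "total_on R q"
    unfolding total_on_def q_def using ordLeq_total RT wo by blast
  moreover have "wf (q - Id)"
  proof (rule wf_subset[OF wf_inv_image[OF wf_ordLess, of p]])
    show "q - Id \<subseteq> inv_image ordLess p"
      by (auto simp: q_def in_inv_image ordLeq_iff_ordLess_or_ordIso dest: R_eq)
  qed
  ultimately have woq: "well_order_on R q"
    unfolding well_order_on_def linear_order_on_def partial_order_on_def preorder_on_def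
    by (auto simp: q_def)
  have Fq: "Field q = R" using well_order_on_Field[OF woq] by simp
  then have Wq: "Well_order q" using woq by simp
  have le: "s \<in> R \<longrightarrow> p s \<le>o Restr q (underS q s)" for s
  proof (induct s rule: wf_induct_rule[OF wf_inv_image[OF wf_ordLess, of p]])
    case (1 s)
    show ?case
    proof
      assume s: "s \<in> R"
      then have sT: "s \<in> T" using RT by blast
      have WR: "Well_order (Restr q (underS q s))" using Wq by (rule Well_order_Restr)
      show "p s \<le>o Restr q (underS q s)"
        unfolding ordLeq_iff_ordLess_Restr[OF wo[OF sT] WR]
      proof
        fix u assume u: "u \<in> Field (p s)"
        then have us: "(u, s) \<in> lt"
          using Well_order_pred_order(2)[OF T sT] by (simp add: p_def preds_def)
        then have uT: "u \<in> T" using T by (auto simp: tree_def)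
        have pu: "Restr (p s) (underS (p s) u) = p u"
          using pred_order_initial[OF T us] by (simp add: p_def)
        have "p u <o p s"
          unfolding ordLess_iff_ordIso_Restr[OF wo[OF sT] wo[OF uT]]
          by (rule bexI[OF _ u]) (simp only: pu ordIso_reflexive[OF wo[OF uT]])
        define v where "v = rep u"
        have v: "v \<in> R" "p v =o p u" using rep[OF uT] uT by (auto simp: v_def R_def)
        have vs: "p v <o p s" using v(2) \<open>p u <o p s\<close> by (rule ordIso_ordLess_trans)
        then have IH: "p v \<le>o Restr q (underS q v)" using 1[of v] v by simp
        have "(v, s) \<in> q" "v \<noteq> s"
          using vs v s ordLess_imp_ordLeq ordLess_irreflexive by (auto simp: q_def)
        have wr: "wo_rel q" using Wq by (simp add: wo_rel_def)
        have "underS q v \<subset> underS q s"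
          using \<open>(v, s) \<in> q\<close> \<open>v \<noteq> s\<close> wo_rel.TRANS[OF wr] wo_rel.ANTISYM[OF wr]
          unfolding underS_def trans_def antisym_def by blast
        then have "Restr q (underS q v) <o Restr q (underS q s)"
          using ofilter_subset_ordLess[OF Wq wo_rel.underS_ofilter[OF wr] wo_rel.underS_ofilter[OF wr]] by blast
        then show "Restr (p s) (underS (p s) u) <o Restr q (underS q s)"
          unfolding pu
          by (rule ordLeq_ordLess_trans[OF ordIso_ordLeq_trans[OF ordIso_symmetric[OF v(2)] IH]])
      qed
    qed
  qed
  have "\<not> pred_order lt t =o q" if t: "t \<in> T" for t
  proof
    assume "pred_order lt t =o q"
    then have a: "p (rep t) =o q"
      using ordIso_transitive[OF rep(2)[OF t]] by (simp add: p_def)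
    have r: "rep t \<in> R" using t by (simp add: R_def)
    then have "Restr q (underS q (rep t)) <o q"
      using underS_Restr_ordLess[OF Wq] Fq by blast
    then have "p (rep t) <o q" by (rule ordLeq_ordLess_trans[OF le[rule_format, OF r]])
    then show False using a not_ordLess_ordIso by blast
  qed
  then show ?thesis using Wq by (auto simp: level_def)
qed

lemma is_height_height:
  fixes T :: "'a set"
  assumes "tree T lt"
  shows "is_height T lt (height T lt)"
proof -
  let ?R = "{r :: 'a rel. Well_order r \<and> level T lt r = {}}"
  have "\<exists>r\<in>?R. \<forall>r'\<in>?R. r \<le>o r'"
    by (rule exists_minim_Well_order) (use ex_Well_order_empty_level[OF assms] in auto)
  then have "\<exists>r. is_height T lt r" by (auto simp: is_height_def)
  then show ?thesis unfolding height_def by (rule someI_ex)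
qed

lemma level_ordIso: "r =o r' \<Longrightarrow> level T lt r = level T lt r'"
  unfolding level_def by (auto elim: ordIso_transitive ordIso_transitive[OF _ ordIso_symmetric])

lemma height_least:
  fixes r :: "'b rel"
  assumes "tree T lt" "Well_order r" "level T lt r = {}"
  shows "height T lt \<le>o r"
proof (rule ccontr)
  note h = is_height_height[OF assms(1), unfolded is_height_def]
  assume "\<not> height T lt \<le>o r"
  then have less: "r <o height T lt" using not_ordLeq_iff_ordLess h assms(2) by blast
  then obtain a where a: "r =o Restr (height T lt) (underS (height T lt) a)"
    using ordLess_iff_ordIso_Restr h assms(2) by blast
  let ?r = "Restr (height T lt) (underS (height T lt) a)"
  have "Well_order ?r" "level T lt ?r = {}"
    using h Well_order_Restr level_ordIso[OF a, of T lt] assms(3) by blast+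
  then have "height T lt \<le>o ?r" using h by blast
  then have "height T lt \<le>o r" by (rule ordLeq_ordIso_trans[OF _ ordIso_symmetric[OF a]])
  then show False using less not_ordLess_ordLeq by blast
qed

end

theory Submission
  imports Defs
begin

text \<open>
  A condensation never lowers heights, and one that preserves all heights is an automorphism
  (\<open>condensation_pred_order_le\<close>, \<open>automorphism_if_heights_preserved\<close>).  So it suffices to prove,
  by induction on the height, that no element is moved to a greater height.

  Suppose that a condensation \<open>f\<close> preserves all heights below \<open>r\<close>.  Then it acts as an automorphism
  on the part of the tree below \<open>r\<close>, and it induces a permutation \<open>F\<close> of the nodes of level \<open>r\<close>:
  the branch below \<open>F N\<close> is the image of the branch below \<open>N\<close>.  An element of \<open>N\<close> is
  mapped either into \<open>F N\<close> or strictly above it, whereas every element of \<open>F N\<close> comes from \<open>N\<close>;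
  hence \<open>|F N| \<le> |N|\<close>.  The part of the tree above \<open>N\<close> is mapped bijectively onto the part above
  \<open>F N\<close>, so these parts have the same cardinality.  Because nodes are finite, \<open>f\<close> preserves level
  \<open>r\<close> as soon as \<open>|F N| = |N|\<close> for all \<open>N\<close>.

  A permutation under which a natural number attached to each index never increases must preserve
  it whenever, for each bound \<open>k\<close>, the set of indices with number at most \<open>k\<close> is finite or
  cofinite: that set is mapped into itself, and finiteness on either side upgrades this to an
  equality (\<open>sizes_preserved_if_decreasing\<close>).  An almost constant sequence has this property; a
  finite-to-one sequence of pairs has it on each set of indices with a given second component, and
  such a set is invariant under the permutation.

  Levels of finite height are finite because nodes are, so their size sequence is trivially almost
  constant; this starts the induction under both conditions.  Under condition (ii) the argument
  above applies to every infinite height.  Under condition (i) the only infinite height is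
  \<open>\<omega>\<close>, and its elements have nowhere higher to go.
\<close>

section \<open>Heights in a tree\<close>

lemma tree_trans: "tree T lt \<Longrightarrow> (x, y) \<in> lt \<Longrightarrow> (y, z) \<in> lt \<Longrightarrow> (x, z) \<in> lt"
  unfolding tree_def by (meson transD)

lemma tree_carrier: "tree T lt \<Longrightarrow> (x, y) \<in> lt \<Longrightarrow> x \<in> T \<and> y \<in> T"
  unfolding tree_def by blast

lemma tree_irrefl: "tree T lt \<Longrightarrow> (x, x) \<notin> lt"
  unfolding tree_def irrefl_def by blast

lemma tree_preds_comparable:
  assumes "tree T lt" "(x, z) \<in> lt" "(y, z) \<in> lt"
  shows "x = y \<or> (x, y) \<in> lt \<or> (y, x) \<in> lt"
proof -
  have "well_order_on (preds lt z) (pred_order lt z)"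
    using assms tree_carrier unfolding tree_def by blast
  then have "total_on (preds lt z) (pred_order lt z)"
    unfolding well_order_on_def linear_order_on_def by blast
  then show ?thesis
    using assms(2,3) unfolding total_on_def pred_order_def preds_def by blast
qed

lemma pred_order_cong: "preds lt s = preds lt t \<Longrightarrow> pred_order lt s = pred_order lt t"
  unfolding pred_order_def by simp

lemma pred_order_less:
  assumes T: "tree T lt" and xy: "(x, y) \<in> lt"
  shows "pred_order lt x <o pred_order lt y"
proof -
  have x: "x \<in> T" and y: "y \<in> T" using tree_carrier[OF T xy] by auto
  have "x \<in> Field (pred_order lt y)"
    using Well_order_pred_order(2)[OF T y] xy by (simp add: preds_def)
  then show ?thesis
    using underS_Restr_ordLess[OF Well_order_pred_order(1)[OF T y], of x]
      pred_order_initial[OF T xy] by auto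
qed

text \<open>
  Every ordinal below the height of \<open>y\<close> is the order type of a proper initial segment of
  the predecessors of \<open>y\<close>, and that segment consists of the predecessors of one element.
\<close>

lemma ex_pred_of_height:
  assumes T: "tree T lt" and y: "y \<in> T" and r: "r <o pred_order lt y"
  shows "\<exists>x. (x, y) \<in> lt \<and> pred_order lt x =o r"
proof -
  have "Well_order r" using r unfolding ordLess_def by auto
  then obtain a where a: "a \<in> Field (pred_order lt y)"
    "r =o Restr (pred_order lt y) (underS (pred_order lt y) a)"
    using r ordLess_iff_ordIso_Restr Well_order_pred_order(1)[OF T y] by blast
  have "(a, y) \<in> lt" using a(1) Well_order_pred_order(2)[OF T y] by (simp add: preds_def)
  then show ?thesis
    using a(2) pred_order_initial[OF T] ordIso_symmetric by fastforce
qed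

lemma pred_of_height_unique:
  assumes T: "tree T lt" and "(x, z) \<in> lt" "(y, z) \<in> lt"
    and e: "pred_order lt x =o pred_order lt y"
  shows "x = y"
proof -
  have "\<not> (x, y) \<in> lt" "\<not> (y, x) \<in> lt"
    using pred_order_less[OF T] e not_ordLess_ordIso ordIso_symmetric by blast+
  then show ?thesis using tree_preds_comparable[OF assms(1-3)] by blast
qed

lemma pred_order_less_height:
  assumes T: "tree T lt" and x: "x \<in> T"
  shows "pred_order lt x <o height T lt"
proof (rule ccontr)
  note h = is_height_height[OF T, unfolded is_height_def]
  note wx = Well_order_pred_order(1)[OF T x]
  assume "\<not> pred_order lt x <o height T lt"
  then have "height T lt \<le>o pred_order lt x" using h wx not_ordLess_iff_ordLeq by blast
  then consider "height T lt <o pred_order lt x" | "height T lt =o pred_order lt x"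
    using ordLeq_iff_ordLess_or_ordIso by blast
  then have "\<exists>z\<in>T. pred_order lt z =o height T lt"
  proof cases
    case 1
    then show ?thesis using ex_pred_of_height[OF T x] tree_carrier[OF T] by blast
  next
    case 2
    then show ?thesis using x ordIso_symmetric by blast
  qed
  then show False using h unfolding level_def by blast
qed

text \<open>
  By induction, each element below \<open>x\<close> has a height at most that of its image, which lies below
  \<open>f x\<close>; so the height of \<open>f x\<close> exceeds all heights below that of \<open>x\<close>.
\<close>

lemma condensation_pred_order_le:
  assumes T: "tree T lt" and f: "condensation T lt f"
  shows "x \<in> T \<Longrightarrow> pred_order lt x \<le>o pred_order lt (f x)"
proof (induct x rule: wf_induct_rule[OF wf_inv_image[OF wf_ordLess, of "pred_order lt"]])
  case (1 x)
  have fx: "f x \<in> T" using f 1(2) unfolding condensation_def bij_betw_def by blast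
  show ?case
    unfolding ordLeq_iff_ordLess_Restr[OF Well_order_pred_order(1)[OF T 1(2)]
        Well_order_pred_order(1)[OF T fx]]
  proof
    fix a assume "a \<in> Field (pred_order lt x)"
    then have a: "(a, x) \<in> lt" using Well_order_pred_order(2)[OF T 1(2)] by (simp add: preds_def)
    then have "a \<in> T" using tree_carrier[OF T] by blast
    then have "pred_order lt a \<le>o pred_order lt (f a)"
      using 1 pred_order_less[OF T a] by simp
    moreover have "pred_order lt (f a) <o pred_order lt (f x)"
      using f a \<open>a \<in> T\<close> 1(2) pred_order_less[OF T] unfolding condensation_def by blast
    ultimately show "Restr (pred_order lt x) (underS (pred_order lt x) a) <o pred_order lt (f x)"
      using pred_order_initial[OF T a] ordLeq_ordLess_trans by auto
  qed
qed

text \<open>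
  If \<open>f x < f y\<close>, let \<open>x'\<close> be the element below \<open>y\<close> of the height of \<open>x\<close>.  Then \<open>f x'\<close> and \<open>f x\<close> are
  elements of the same height below \<open>f y\<close>, hence equal.
\<close>

lemma automorphism_if_heights_preserved:
  assumes T: "tree T lt" and f: "condensation T lt f"
    and h: "\<And>x. x \<in> T \<Longrightarrow> pred_order lt (f x) =o pred_order lt x"
  shows "automorphism T lt f"
proof -
  have "(x, y) \<in> lt" if x: "x \<in> T" and y: "y \<in> T" and l: "(f x, f y) \<in> lt" for x y
  proof -
    have "pred_order lt x <o pred_order lt y"
      using pred_order_less[OF T l] h[OF x] h[OF y]
      by (meson ordIso_symmetric ordIso_ordLess_trans ordLess_ordIso_trans)
    then obtain x' where x': "(x', y) \<in> lt" "pred_order lt x' =o pred_order lt x"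
      using ex_pred_of_height[OF T y] by blast
    have x'T: "x' \<in> T" using tree_carrier[OF T x'(1)] by blast
    have "(f x', f y) \<in> lt" using f x'(1) x'T y unfolding condensation_def by blast
    moreover have "pred_order lt (f x') =o pred_order lt (f x)"
      using h[OF x'T] h[OF x] x'(2) by (meson ordIso_symmetric ordIso_transitive)
    ultimately have "f x' = f x" using pred_of_height_unique[OF T _ l] by blast
    then have "x' = x" using f x x'T unfolding condensation_def bij_betw_def inj_on_def by blast
    then show ?thesis using x'(1) by simp
  qed
  then show ?thesis using f unfolding automorphism_def condensation_def by blast
qed

section \<open>Nodes of a level\<close>

definition node :: "'a set \<Rightarrow> 'a rel \<Rightarrow> 'a set \<Rightarrow> 'a set" where
  "node T lt B = {t \<in> T. preds lt t = B}"

lemma nodes_eq: "nodes T lt = (\<lambda>y. node T lt (preds lt y)) ` T"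
  unfolding nodes_def quotient_def node_def by auto

lemma level_cong:
  assumes "t \<in> T" "preds lt t = preds lt y" "y \<in> level T lt r"
  shows "t \<in> level T lt r"
  using assms pred_order_cong[OF assms(2)] unfolding level_def by simp

lemma level_nodes_eq:
  "level_nodes T lt r = (\<lambda>y. node T lt (preds lt y)) ` level T lt r"
proof -
  have "node T lt (preds lt y) \<subseteq> level T lt r \<longleftrightarrow> y \<in> level T lt r" if "y \<in> T" for y
    unfolding node_def using that level_cong[of _ T lt y r] by blast
  moreover have "level T lt r \<subseteq> T" unfolding level_def by blast
  ultimately show ?thesis unfolding level_nodes_def nodes_eq by blast
qed

text \<open>
  For an element \<open>t\<close> of height at least \<open>r\<close> this is the initial segment of order type \<open>r\<close> of the
  branch leading to \<open>t\<close>.  It identifies the node of level \<open>r\<close> through which this branch passes.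
\<close>

definition trunc_preds :: "'a rel \<Rightarrow> 'a rel \<Rightarrow> 'a \<Rightarrow> 'a set" where
  "trunc_preds lt r t = {s \<in> preds lt t. pred_order lt s <o r}"

lemma ex_restriction_to_level:
  assumes T: "tree T lt" and t: "t \<in> T" and r: "r \<le>o pred_order lt t"
  shows "\<exists>s \<in> level T lt r. (s, t) \<in> lt\<^sup>="
proof (cases "r <o pred_order lt t")
  case True
  then show ?thesis
    using ex_pred_of_height[OF T t] tree_carrier[OF T] unfolding level_def by blast
next
  case False
  then have "r =o pred_order lt t" using r ordLeq_iff_ordLess_or_ordIso by blast
  then show ?thesis using t ordIso_symmetric unfolding level_def by blast
qed

lemma trunc_preds_above_level:
  assumes T: "tree T lt" and s: "s \<in> level T lt r" and st: "(s, t) \<in> lt\<^sup>="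
  shows "trunc_preds lt r t = preds lt s"
proof -
  have sr: "pred_order lt s =o r" using s unfolding level_def by blast
  show ?thesis
  proof (rule set_eqI)
    fix p
    have "(p, s) \<in> lt" if "(p, t) \<in> lt" "pred_order lt p <o r"
    proof -
      have ps: "pred_order lt p <o pred_order lt s"
        using that(2) sr ordIso_symmetric ordLess_ordIso_trans by blast
      have "p \<noteq> s" using ps ordLess_irreflexive by blast
      moreover have "(s, p) \<notin> lt"
        using ps pred_order_less[OF T] not_ordLess_ordLeq ordLess_imp_ordLeq by blast
      ultimately show ?thesis
        using that(1) st tree_preds_comparable[OF T that(1), of s] by blast
    qed
    moreover have "(p, t) \<in> lt \<and> pred_order lt p <o r" if "(p, s) \<in> lt"
      using that st tree_trans[OF T] pred_order_less[OF T that] sr ordLess_ordIso_trans by blast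
    ultimately show "p \<in> trunc_preds lt r t \<longleftrightarrow> p \<in> preds lt s"
      unfolding trunc_preds_def preds_def by blast
  qed
qed

text \<open>
  This describes the part of the tree above a node through what happens below the level, where a
  condensation is under control.
\<close>

lemma upset_node_eq:
  assumes T: "tree T lt" and y: "y \<in> level T lt r"
  shows "upset T lt (node T lt (preds lt y)) =
    {t \<in> T. r \<le>o pred_order lt t \<and> trunc_preds lt r t = preds lt y}" (is "?A = ?B")
proof
  show "?A \<subseteq> ?B"
  proof
    fix t assume "t \<in> ?A"
    then obtain s where s: "t \<in> T" "s \<in> T" "preds lt s = preds lt y" "(s, t) \<in> lt\<^sup>="
      unfolding upset_def node_def by blast
    note sL = level_cong[OF s(2,3) y]
    then have sr: "r =o pred_order lt s" using ordIso_symmetric unfolding level_def by blast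
    have "r \<le>o pred_order lt t"
      using s(4) sr pred_order_less[OF T, of s t] ordIso_ordLess_trans ordLess_imp_ordLeq
        ordIso_imp_ordLeq by (metis (no_types, lifting) UnE pair_in_Id_conv)
    then show "t \<in> ?B" using s trunc_preds_above_level[OF T sL s(4)] by simp
  qed
  show "?B \<subseteq> ?A"
  proof
    fix t assume t: "t \<in> ?B"
    then obtain s where s: "s \<in> level T lt r" "(s, t) \<in> lt\<^sup>="
      using ex_restriction_to_level[OF T] by blast
    then have "s \<in> T" "preds lt s = preds lt y"
      using t trunc_preds_above_level[OF T s] unfolding level_def by auto
    then show "t \<in> ?A" using t s(2) unfolding upset_def node_def by blast
  qed
qed

section \<open>Levels of finite height\<close>

text \<open>
  The predecessor set of an element of height \<open>n\<close> is a subset of the union of the lower levels,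
  which is finite by induction.  So there are finitely many such sets, and each belongs to one
  node.
\<close>

lemma finite_level_of_finite_height:
  assumes T: "tree T lt" and N: "\<And>N. N \<in> nodes T lt \<Longrightarrow> finite N"
  shows "finite {t \<in> T. finite (preds lt t) \<and> card (preds lt t) = n}" (is "finite (?L n)")
proof (induct n rule: less_induct)
  case (less n)
  let ?U = "\<Union>m<n. ?L m"
  have sub: "preds lt t \<subseteq> ?U" if t: "t \<in> ?L n" for t
  proof
    fix s assume "s \<in> preds lt t"
    then have s: "(s, t) \<in> lt" by (simp add: preds_def)
    then have "preds lt s \<subset> preds lt t"
      using tree_trans[OF T _ s] tree_irrefl[OF T, of s] unfolding preds_def by blast
    then have "card (preds lt s) < n" "finite (preds lt s)"
      using t psubset_card_mono finite_subset[of "preds lt s"] by auto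
    then show "s \<in> ?U" using tree_carrier[OF T s] by auto
  qed
  have "finite ?U" using less by blast
  moreover have "preds lt ` ?L n \<subseteq> Pow ?U" using sub by blast
  ultimately have fin: "finite (preds lt ` ?L n)" by (meson finite_Pow_iff finite_subset)
  let ?V = "\<Union>B\<in>preds lt ` ?L n. node T lt B"
  have "finite (node T lt B)" if "B \<in> preds lt ` ?L n" for B
    using that N unfolding nodes_eq by blast
  then have "finite ?V" using fin by (rule finite_UN_I[rotated])
  moreover have "?L n \<subseteq> ?V" unfolding node_def by blast
  ultimately show ?case by (rule finite_subset[rotated])
qed

section \<open>Permutations that do not increase sizes\<close>

text \<open>
  An injective self-map of a finite set is onto.  If \<open>A\<close> is finite, this applies to \<open>A\<close>; if its
  complement is finite, it applies to the inverse of \<open>F\<close> on the complement.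
\<close>

lemma bij_invariant_set_backwards:
  assumes F: "bij_betw F J J" and A: "A \<subseteq> J" "F ` A \<subseteq> A"
    and fin: "finite A \<or> finite (J - A)" and j: "j \<in> J" "F j \<in> A"
  shows "j \<in> A"
proof -
  have inj: "inj_on F J" and surj: "F ` J = J" using F unfolding bij_betw_def by auto
  show ?thesis
  proof (cases "finite A")
    case True
    then have "F ` A = A" using endo_inj_surj A inj_on_subset[OF inj A(1)] by blast
    then obtain a where "a \<in> A" "F a = F j" using j(2) by force
    then show ?thesis using inj j(1) A(1) unfolding inj_on_def by blast
  next
    case False
    then have f: "finite (J - A)" using fin by blast
    have "J - A \<subseteq> F ` (J - A)" using surj A by blast
    moreover have "card (F ` (J - A)) = card (J - A)"
      using card_image inj_on_subset[OF inj] by blast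
    ultimately have "F ` (J - A) = J - A" using f card_subset_eq by (metis finite_imageI)
    then show ?thesis using j by blast
  qed
qed

text \<open>
  If \<open>s\<close> dropped at \<open>j\<close>, then \<open>j\<close> would lie outside the sublevel set of \<open>s\<close> at \<open>s (F j)\<close> while \<open>F j\<close>
  lies inside.  \<open>F\<close> maps each sublevel set into itself, so the previous lemma excludes this once the
  sublevel set, possibly restricted to a value of \<open>u\<close>, is finite or cofinite.
\<close>

lemma sizes_preserved_if_decreasing:
  fixes s :: "'i \<Rightarrow> nat" and u :: "'i \<Rightarrow> 'c"
  assumes F: "bij_betw F J J" and s: "\<And>j. j \<in> J \<Longrightarrow> s (F j) \<le> s j"
    and u: "\<And>j. j \<in> J \<Longrightarrow> u (F j) = u j"
    and cond: "almost_constant s J \<or> finite_to_one (\<lambda>j. (s j, u j)) J"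
    and j: "j \<in> J"
  shows "s (F j) = s j"
proof -
  have FJ: "F i \<in> J" if "i \<in> J" for i using F that unfolding bij_betw_def by blast
  let ?k = "s (F j)"
  from cond have "s j \<le> ?k"
  proof
    assume "almost_constant s J"
    then obtain c where c: "finite {i \<in> J. s i \<noteq> c}" unfolding almost_constant_def by blast
    let ?A = "{i \<in> J. s i \<le> ?k}"
    have "finite ?A \<or> finite (J - ?A)"
    proof (cases "c \<le> ?k")
      case True
      then have "J - ?A \<subseteq> {i \<in> J. s i \<noteq> c}" by auto
      then show ?thesis using c finite_subset by blast
    next
      case False
      then have "?A \<subseteq> {i \<in> J. s i \<noteq> c}" by auto
      then show ?thesis using c finite_subset by blast
    qed
    moreover have "F ` ?A \<subseteq> ?A" using FJ s by (auto intro: order_trans)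
    ultimately have "j \<in> ?A" using bij_invariant_set_backwards[OF F, of ?A j] j FJ by blast
    then show ?thesis by blast
  next
    assume fo: "finite_to_one (\<lambda>j. (s j, u j)) J"
    let ?A = "{i \<in> J. s i \<le> ?k \<and> u i = u j}"
    have "?A \<subseteq> (\<Union>n\<le>?k. {i \<in> J. (s i, u i) = (n, u j)})" by auto
    moreover have "finite (\<Union>n\<le>?k. {i \<in> J. (s i, u i) = (n, u j)})"
      using fo unfolding finite_to_one_def by blast
    ultimately have "finite ?A" using finite_subset by blast
    moreover have "F ` ?A \<subseteq> ?A" using FJ s u by (auto intro: order_trans)
    ultimately have "j \<in> ?A" using bij_invariant_set_backwards[OF F, of ?A j] j FJ u by auto
    then show ?thesis by blast
  qed
  then show ?thesis using s[OF j] by simp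
qed

section \<open>The action of a condensation on the nodes of one level\<close>

text \<open>
  The situation of the induction step: a condensation that is already known to preserve all
  heights below \<open>r\<close>.  Since such a condensation permutes the part of the tree below \<open>r\<close> and
  respects its order in both directions, it carries the branch below a node of level \<open>r\<close> to the
  branch below a node of that level.
\<close>

locale level_step =
  fixes T :: "'a set" and lt :: "'a rel" and f :: "'a \<Rightarrow> 'a" and r :: "'a rel"
  assumes tree: "tree T lt"
    and condensation: "condensation T lt f"
    and below: "x \<in> T \<Longrightarrow> pred_order lt x <o r \<Longrightarrow> pred_order lt (f x) =o pred_order lt x"
    and wo: "Well_order r"
begin

lemma inj: "inj_on f T" and surj: "f ` T = T"
  using condensation unfolding condensation_def bij_betw_def by auto

lemma image_in_T: "y \<in> T \<Longrightarrow> f y \<in> T"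
  using surj by blast

lemma mono: "(y, z) \<in> lt \<Longrightarrow> (f y, f z) \<in> lt"
  using condensation tree_carrier[OF tree] unfolding condensation_def by blast

lemma preds_subset: "preds lt y \<subseteq> T"
  using tree_carrier[OF tree] unfolding preds_def by blast

lemma image_eq_iff: "A \<subseteq> T \<Longrightarrow> B \<subseteq> T \<Longrightarrow> f ` A = f ` B \<longleftrightarrow> A = B"
  by (rule inj_on_image_eq_iff[OF inj])

lemma level_iff: "y \<in> level T lt r \<longleftrightarrow> y \<in> T \<and> r \<le>o pred_order lt y \<and> pred_order lt y \<le>o r"
  unfolding level_def ordIso_iff_ordLeq by blast

lemma above_level_iff:
  assumes y: "y \<in> T"
  shows "r \<le>o pred_order lt (f y) \<longleftrightarrow> r \<le>o pred_order lt y"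
proof
  assume a: "r \<le>o pred_order lt (f y)"
  show "r \<le>o pred_order lt y"
  proof (rule ccontr)
    assume "\<not> r \<le>o pred_order lt y"
    then have l: "pred_order lt y <o r"
      using wo Well_order_pred_order(1)[OF tree y] not_ordLeq_iff_ordLess by blast
    then have "pred_order lt (f y) <o r"
      using below[OF y l] ordIso_ordLess_trans by blast
    then show False using a not_ordLess_ordLeq by blast
  qed
next
  assume "r \<le>o pred_order lt y"
  then show "r \<le>o pred_order lt (f y)"
    using condensation_pred_order_le[OF tree condensation y] ordLeq_transitive by blast
qed

lemma level_preimage:
  assumes y: "y \<in> T" and fy: "f y \<in> level T lt r"
  shows "y \<in> level T lt r"
  using assms above_level_iff[OF y] condensation_pred_order_le[OF tree condensation y]
    ordLeq_transitive unfolding level_iff by blast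

text \<open>
  Surjectivity of \<open>f\<close> on the initial segment uses that it has exactly one element of each height:
  an element of the branch below \<open>f y\<close> is the image of the element of the same height below \<open>y\<close>.
\<close>

lemma trunc_preds_image:
  assumes y: "y \<in> T" "r \<le>o pred_order lt y"
  shows "trunc_preds lt r (f y) = f ` trunc_preds lt r y"
proof
  show "f ` trunc_preds lt r y \<subseteq> trunc_preds lt r (f y)"
    using mono below preds_subset[of y] ordIso_ordLess_trans
    unfolding trunc_preds_def preds_def by blast
  show "trunc_preds lt r (f y) \<subseteq> f ` trunc_preds lt r y"
  proof
    fix q assume "q \<in> trunc_preds lt r (f y)"
    then have q: "(q, f y) \<in> lt" "pred_order lt q <o r"
      unfolding trunc_preds_def preds_def by auto
    then obtain p where p: "(p, y) \<in> lt" "pred_order lt p =o pred_order lt q"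
      using ex_pred_of_height[OF tree y(1) ordLess_ordLeq_trans[OF q(2) y(2)]] by blast
    have pr: "pred_order lt p <o r" using p(2) q(2) ordIso_ordLess_trans by blast
    have "p \<in> T" using tree_carrier[OF tree p(1)] by blast
    then have "pred_order lt (f p) =o pred_order lt q"
      using below[OF _ pr] p(2) ordIso_transitive by blast
    then have "f p = q" using pred_of_height_unique[OF tree mono[OF p(1)] q(1)] by blast
    then show "q \<in> f ` trunc_preds lt r y"
      using p(1) pr unfolding trunc_preds_def preds_def by blast
  qed
qed

lemma trunc_preds_level: "y \<in> level T lt r \<Longrightarrow> trunc_preds lt r y = preds lt y"
  using trunc_preds_above_level[OF tree] by simp

text \<open>
  The element \<open>f y\<close> itself may lie above level \<open>r\<close>; the witness is the element of level \<open>r\<close>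
  below it.
\<close>

lemma ex_level_above_image:
  assumes y: "y \<in> level T lt r"
  obtains y' where "y' \<in> level T lt r" "preds lt y' = f ` preds lt y"
proof -
  have yT: "y \<in> T" "r \<le>o pred_order lt y" using y unfolding level_iff by auto
  then obtain y' where y': "y' \<in> level T lt r" "(y', f y) \<in> lt\<^sup>="
    using ex_restriction_to_level[OF tree image_in_T[OF yT(1)]] above_level_iff by blast
  then have "preds lt y' = f ` preds lt y"
    using trunc_preds_above_level[OF tree y'] trunc_preds_image[OF yT] trunc_preds_level[OF y]
    by simp
  then show ?thesis using that y'(1) by blast
qed

lemma level_image_of_level:
  assumes z: "z \<in> level T lt r"
  obtains w where "w \<in> level T lt r" "z = f w" "preds lt z = f ` preds lt w"
proof -
  obtain w where w: "w \<in> T" "z = f w" using z surj unfolding level_def by blast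
  then have wL: "w \<in> level T lt r" using level_preimage z by blast
  then have "trunc_preds lt r z = f ` trunc_preds lt r w"
    using trunc_preds_image[OF w(1)] w(2) unfolding level_iff by blast
  then have "preds lt z = f ` preds lt w"
    unfolding trunc_preds_level[OF wL] trunc_preds_level[OF z] .
  then show ?thesis using that wL w(2) by blast
qed

definition node_map :: "'a set \<Rightarrow> 'a set" where
  "node_map N = {t \<in> T. \<exists>y\<in>N. preds lt t = f ` preds lt y}"

lemma node_map_node: "y \<in> T \<Longrightarrow> node_map (node T lt (preds lt y)) = node T lt (f ` preds lt y)"
  unfolding node_map_def node_def by auto

lemma level_node_cases:
  assumes "N \<in> level_nodes T lt r"
  obtains y y' where "y \<in> level T lt r" "N = node T lt (preds lt y)"
    "y' \<in> level T lt r" "preds lt y' = f ` preds lt y" "node_map N = node T lt (preds lt y')"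
proof -
  obtain y where y: "y \<in> level T lt r" "N = node T lt (preds lt y)"
    using assms unfolding level_nodes_eq by blast
  obtain y' where y': "y' \<in> level T lt r" "preds lt y' = f ` preds lt y"
    using ex_level_above_image[OF y(1)] .
  have "y \<in> T" using y(1) unfolding level_def by blast
  then have "node_map N = node T lt (preds lt y')" using node_map_node y(2) y'(2) by simp
  then show ?thesis using that y y' by blast
qed

lemma bij_node_map: "bij_betw node_map (level_nodes T lt r) (level_nodes T lt r)"
  unfolding bij_betw_def
proof
  show "inj_on node_map (level_nodes T lt r)"
  proof (rule inj_onI)
    fix M N
    assume M: "M \<in> level_nodes T lt r" and N: "N \<in> level_nodes T lt r"
      and eq: "node_map M = node_map N"
    obtain x x' where x: "M = node T lt (preds lt x)" "x' \<in> level T lt r"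
      "preds lt x' = f ` preds lt x" "node_map M = node T lt (preds lt x')"
      using level_node_cases[OF M] .
    obtain y y' where y: "N = node T lt (preds lt y)"
      "preds lt y' = f ` preds lt y" "node_map N = node T lt (preds lt y')"
      using level_node_cases[OF N] .
    have "x' \<in> node T lt (preds lt y')"
      using x(2,4) y(3) eq unfolding node_def level_def by blast
    then have "f ` preds lt x = f ` preds lt y" using x(3) y(2) unfolding node_def by simp
    then have "preds lt x = preds lt y" using image_eq_iff[OF preds_subset preds_subset] by blast
    then show "M = N" using x(1) y(1) by simp
  qed
  show "node_map ` level_nodes T lt r = level_nodes T lt r"
  proof
    show "node_map ` level_nodes T lt r \<subseteq> level_nodes T lt r"
    proof
      fix M assume "M \<in> node_map ` level_nodes T lt r"
      then obtain N where N: "N \<in> level_nodes T lt r" and M: "M = node_map N" by blast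
      obtain y' where "y' \<in> level T lt r" "node_map N = node T lt (preds lt y')"
        using level_node_cases[OF N] by metis
      then show "M \<in> level_nodes T lt r" unfolding M level_nodes_eq by blast
    qed
    show "level_nodes T lt r \<subseteq> node_map ` level_nodes T lt r"
    proof
      fix M assume "M \<in> level_nodes T lt r"
      then obtain z where z: "z \<in> level T lt r" "M = node T lt (preds lt z)"
        unfolding level_nodes_eq by blast
      obtain w where w: "w \<in> level T lt r" "preds lt z = f ` preds lt w"
        using level_image_of_level[OF z(1)] by metis
      have "w \<in> T" using w(1) unfolding level_def by blast
      then have "M = node_map (node T lt (preds lt w))" using z(2) w(2) node_map_node by simp
      then show "M \<in> node_map ` level_nodes T lt r" using w(1) unfolding level_nodes_eq by blast
    qed
  qed
qed

text \<open>
  Elements of level \<open>r\<close> come only from elements of level \<open>r\<close>, because heights never decrease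
  and those below \<open>r\<close> are preserved.
  This is the inclusion that makes node sizes decrease along \<^term>\<open>node_map\<close>; when
  the sizes agree, it becomes an equality, and no element of \<open>N\<close> leaves the level.
\<close>

lemma node_map_subset_image:
  assumes N: "N \<in> level_nodes T lt r"
  shows "node_map N \<subseteq> f ` N"
proof
  obtain y y' where y: "N = node T lt (preds lt y)" "y' \<in> level T lt r"
    "preds lt y' = f ` preds lt y" "node_map N = node T lt (preds lt y')"
    using level_node_cases[OF N] .
  fix z assume "z \<in> node_map N"
  then have z: "z \<in> T" "preds lt z = preds lt y'" using y(4) unfolding node_def by auto
  then have "z \<in> level T lt r" using level_cong y(2) by metis
  then obtain w where w: "w \<in> level T lt r" "z = f w" "preds lt z = f ` preds lt w"
    by (rule level_image_of_level)
  then have "f ` preds lt w = f ` preds lt y" using z(2) y(3) by simp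
  then have "preds lt w = preds lt y" using image_eq_iff[OF preds_subset preds_subset] by blast
  then show "z \<in> f ` N" using w(1,2) y(1) unfolding node_def level_def by blast
qed

lemma card_node_map_le:
  assumes "N \<in> level_nodes T lt r" "finite N"
  shows "card (node_map N) \<le> card N"
  using card_mono[OF finite_imageI[OF assms(2)] node_map_subset_image[OF assms(1)]]
    card_image_le[OF assms(2), of f] by linarith

text \<open>
  Unlike the node itself, the whole part of the tree above it is mapped onto the part above its
  image: membership there depends only on the initial segment of height \<open>r\<close>, on which \<open>f\<close> acts
  injectively.
\<close>

lemma image_upset_node:
  assumes N: "N \<in> level_nodes T lt r"
  shows "f ` upset T lt N = upset T lt (node_map N)"
proof -
  obtain y y' where y: "y \<in> level T lt r" "N = node T lt (preds lt y)"
    "y' \<in> level T lt r" "preds lt y' = f ` preds lt y" "node_map N = node T lt (preds lt y')"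
    using level_node_cases[OF N] .
  have U: "upset T lt N = {t \<in> T. r \<le>o pred_order lt t \<and> trunc_preds lt r t = preds lt y}"
    unfolding y(2) by (rule upset_node_eq[OF tree y(1)])
  have V: "upset T lt (node_map N) =
      {t \<in> T. r \<le>o pred_order lt t \<and> trunc_preds lt r t = f ` preds lt y}"
    using upset_node_eq[OF tree y(3)] unfolding y(5) unfolding y(4) .
  have iff: "trunc_preds lt r (f w) = f ` preds lt y \<longleftrightarrow> trunc_preds lt r w = preds lt y"
    if w: "w \<in> T" "r \<le>o pred_order lt w" for w
  proof -
    have "trunc_preds lt r w \<subseteq> T" using preds_subset unfolding trunc_preds_def by blast
    then show ?thesis
      unfolding trunc_preds_image[OF w] using image_eq_iff preds_subset by blast
  qed
  show ?thesis
  proof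
    show "f ` upset T lt N \<subseteq> upset T lt (node_map N)"
    proof
      fix z assume "z \<in> f ` upset T lt N"
      then obtain w where w: "z = f w" "w \<in> T" "r \<le>o pred_order lt w"
        "trunc_preds lt r w = preds lt y" unfolding U by blast
      then have "trunc_preds lt r z = f ` preds lt y" using iff by simp
      moreover have "r \<le>o pred_order lt z" using w above_level_iff by simp
      ultimately show "z \<in> upset T lt (node_map N)"
        unfolding V using w(1) image_in_T[OF w(2)] by blast
    qed
    show "upset T lt (node_map N) \<subseteq> f ` upset T lt N"
    proof
      fix z assume "z \<in> upset T lt (node_map N)"
      then have z: "z \<in> T" "r \<le>o pred_order lt z" "trunc_preds lt r z = f ` preds lt y"
        unfolding V by auto
      then obtain w where w: "w \<in> T" "z = f w" using surj by blast
      then have "r \<le>o pred_order lt w" using z(2) above_level_iff by simp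
      moreover from this have "trunc_preds lt r w = preds lt y" using z(3) w iff by simp
      ultimately have "w \<in> upset T lt N" unfolding U using w(1) by blast
      then show "z \<in> f ` upset T lt N" using w(2) by blast
    qed
  qed
qed

lemma cardinal_upset_node_map:
  assumes N: "N \<in> level_nodes T lt r"
  shows "cardinal (upset T lt (node_map N)) = cardinal (upset T lt N)"
proof -
  have "upset T lt N \<subseteq> T" unfolding upset_def by blast
  then have "bij_betw f (upset T lt N) (upset T lt (node_map N))"
    using inj_on_subset[OF inj] image_upset_node[OF N] unfolding bij_betw_def by blast
  then have e: "upset T lt N \<approx> upset T lt (node_map N)" unfolding eqpoll_def by blast
  have "B \<approx> upset T lt (node_map N) \<longleftrightarrow> B \<approx> upset T lt N" for B :: "'a set"
    using eqpoll_trans[OF _ e, of B] eqpoll_trans[OF _ eqpoll_sym[OF e], of B] by blast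
  then show ?thesis unfolding cardinal_def by simp
qed

lemma level_preserved:
  assumes fin: "\<And>N. N \<in> nodes T lt \<Longrightarrow> finite N"
    and cond: "almost_constant card (level_nodes T lt r) \<or>
      finite_to_one (\<lambda>N. (card N, cardinal (upset T lt N))) (level_nodes T lt r)"
    and x: "x \<in> level T lt r"
  shows "f x \<in> level T lt r"
proof -
  have fin': "finite N" if "N \<in> level_nodes T lt r" for N
    using fin that unfolding level_nodes_def by blast
  let ?N = "node T lt (preds lt x)"
  have N: "?N \<in> level_nodes T lt r" using x unfolding level_nodes_eq by blast
  have "card (node_map ?N) = card ?N"
  proof (rule sizes_preserved_if_decreasing[OF bij_node_map _ _ cond N])
    show "card (node_map M) \<le> card M" if "M \<in> level_nodes T lt r" for M
      using card_node_map_le[OF that fin'[OF that]] .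
    show "cardinal (upset T lt (node_map M)) = cardinal (upset T lt M)"
      if "M \<in> level_nodes T lt r" for M
      using cardinal_upset_node_map[OF that] .
  qed
  then have "card (f ` ?N) \<le> card (node_map ?N)" using card_image_le[OF fin'[OF N], of f] by simp
  then have "node_map ?N = f ` ?N"
    by (rule card_seteq[OF finite_imageI[OF fin'[OF N]] node_map_subset_image[OF N]])
  moreover have "x \<in> ?N" using x unfolding node_def level_def by simp
  ultimately have "f x \<in> node_map ?N" by blast
  moreover have "node_map ?N \<in> level_nodes T lt r"
    using bij_node_map N unfolding bij_betw_def by blast
  ultimately show ?thesis unfolding level_nodes_def by blast
qed

end

section \<open>Reversibility\<close>

text \<open>
  A proper initial segment of the successor of \<open>s\<close> omits the top element, so it is contained in a
  copy of \<open>s\<close>.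
\<close>

lemma ordLess_ord_succ_imp_ordLeq:
  assumes s: "Well_order s" and r: "r <o ord_succ s"
  shows "r \<le>o s"
proof -
  let ?S = "ord_succ s"
  have W: "Well_order ?S" using Well_order_ord_succ[OF s] .
  have wS: "wo_rel ?S" using W by (simp add: wo_rel_def)
  have "Well_order r" using r unfolding ordLess_def by auto
  then obtain a where a: "r =o Restr ?S (underS ?S a)"
    using r ordLess_iff_ordIso_Restr[OF W] by blast
  have top: "underS ?S None = Some ` Field s" unfolding underS_def ord_succ_def by auto
  have "underS ?S a \<subseteq> underS ?S None"
    unfolding top unfolding underS_def ord_succ_def by (auto intro: FieldI1)
  then have le: "Restr ?S (underS ?S a) \<le>o Restr ?S (underS ?S None)"
    using ofilter_subset_ordLeq[OF W wo_rel.underS_ofilter[OF wS] wo_rel.underS_ofilter[OF wS]]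
    by blast
  have dir: "Restr ?S (underS ?S None) = dir_image s Some"
    unfolding top unfolding ord_succ_def dir_image_def by (auto intro: FieldI1 FieldI2)
  have "s =o dir_image s Some" by (rule dir_image_ordIso[OF s]) simp
  then have "Restr ?S (underS ?S None) =o s" using dir ordIso_symmetric by simp
  then show ?thesis using a le ordIso_ordLeq_trans ordLeq_ordIso_trans by blast
qed

theorem theorem5p1:
  fixes T :: "'a set" and lt :: "'a rel"
  assumes "tree T lt"
    and "\<forall>N \<in> nodes T lt. finite N"
  shows "(height T lt \<le>o ord_succ natLeq \<longrightarrow> reversible T lt) \<and>
    ((\<forall>\<alpha> :: 'a rel. natLeq \<le>o \<alpha> \<and> \<alpha> <o height T lt \<longrightarrow>
        almost_constant (\<lambda>N. card N) (level_nodes T lt \<alpha>) \<or>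
        finite_to_one (\<lambda>N. (card N, cardinal (upset T lt N))) (level_nodes T lt \<alpha>))
      \<longrightarrow> reversible T lt)"
proof -
  note T = assms(1)
  have N: "\<And>N. N \<in> nodes T lt \<Longrightarrow> finite N" using assms(2) by blast
  have wo: "Well_order (pred_order lt y)" if "y \<in> T" for y
    using Well_order_pred_order(1)[OF T that] .
  have step: "f x \<in> level T lt (pred_order lt x)"
    if f: "condensation T lt f" and x: "x \<in> T"
      and below: "\<And>y. y \<in> T \<Longrightarrow> pred_order lt y <o pred_order lt x \<Longrightarrow>
        pred_order lt (f y) =o pred_order lt y"
      and cond: "almost_constant card (level_nodes T lt (pred_order lt x)) \<or>
        finite_to_one (\<lambda>N. (card N, cardinal (upset T lt N)))
          (level_nodes T lt (pred_order lt x))" for f x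
  proof -
    interpret level_step T lt f "pred_order lt x"
      using T f below wo[OF x] by unfold_locales
    show ?thesis
      by (rule level_preserved[OF N cond])
        (use x wo ordIso_reflexive in \<open>auto simp: level_def\<close>)
  qed
  \<comment> \<open>The induction on heights common to both parts, which differ only at infinite heights.\<close>
  have rev: "reversible T lt"
    if infinite_level: "\<And>f x. condensation T lt f \<Longrightarrow> x \<in> T \<Longrightarrow> natLeq \<le>o pred_order lt x \<Longrightarrow>
      (\<And>y. y \<in> T \<Longrightarrow> pred_order lt y <o pred_order lt x \<Longrightarrow> pred_order lt (f y) =o pred_order lt y) \<Longrightarrow>
      pred_order lt (f x) =o pred_order lt x"
    unfolding reversible_def
  proof (intro allI impI)
    fix f assume f: "condensation T lt f"
    have "pred_order lt (f x) =o pred_order lt x" if "x \<in> T" for x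
      using that
    proof (induct x rule: wf_induct_rule[OF wf_inv_image[OF wf_ordLess, of "pred_order lt"]])
      case (1 x)
      then have below: "pred_order lt (f y) =o pred_order lt y"
        if "y \<in> T" "pred_order lt y <o pred_order lt x" for y using that by simp
      show ?case
      proof (cases "natLeq \<le>o pred_order lt x")
        case True
        then show ?thesis using infinite_level[OF f 1(2) True below] by blast
      next
        case False
        let ?r = "pred_order lt x"
        have "?r <o natLeq"
          using False wo[OF 1(2)] natLeq_Well_order not_ordLeq_iff_ordLess by blast
        moreover have "|Field ?r| \<le>o ?r" using wo[OF 1(2)] card_of_least by blast
        ultimately have "|Field ?r| <o natLeq" using ordLeq_ordLess_trans by blast
        then have fin: "finite (preds lt x)"
          unfolding Well_order_pred_order(2)[OF T 1(2)] by (rule finite_iff_ordLess_natLeq[THEN iffD2])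
        \<comment> \<open>Isomorphic branches have the same number of elements, so the level is one of the finite ones.\<close>
        have "level T lt ?r \<subseteq>
          {t \<in> T. finite (preds lt t) \<and> card (preds lt t) = card (preds lt x)}"
        proof
          fix t assume t: "t \<in> level T lt ?r"
          then have tT: "t \<in> T" and iso: "pred_order lt t =o ?r" unfolding level_def by auto
          obtain g where "bij_betw g (preds lt t) (preds lt x)"
            using iso Well_order_pred_order(2)[OF T tT] Well_order_pred_order(2)[OF T 1(2)]
            unfolding ordIso_def iso_def by auto
          then show "t \<in> {t \<in> T. finite (preds lt t) \<and> card (preds lt t) = card (preds lt x)}"
            using tT fin bij_betw_finite bij_betw_same_card by blast
        qed
        then have "finite (level T lt ?r)"
          using finite_level_of_finite_height[OF T N] finite_subset by blast
        then have "finite (level_nodes T lt ?r)" unfolding level_nodes_eq by blast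
        then have "almost_constant card (level_nodes T lt ?r)" unfolding almost_constant_def by simp
        then have "f x \<in> level T lt ?r" using step[OF f 1(2) below] by blast
        then show ?thesis unfolding level_def by blast
      qed
    qed
    then show "automorphism T lt f" by (rule automorphism_if_heights_preserved[OF T f])
  qed
  show ?thesis
  proof (intro conjI impI)
    assume h: "height T lt \<le>o ord_succ natLeq"
    show "reversible T lt"
    proof (rule rev)
      fix f x assume f: "condensation T lt f" and x: "x \<in> T" and i: "natLeq \<le>o pred_order lt x"
      have fx: "f x \<in> T" using f x unfolding condensation_def bij_betw_def by blast
      have "pred_order lt (f x) <o ord_succ natLeq"
        using ordLess_ordLeq_trans[OF pred_order_less_height[OF T fx] h] .
      then have "pred_order lt (f x) \<le>o natLeq"
        by (rule ordLess_ord_succ_imp_ordLeq[OF natLeq_Well_order])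
      then have "pred_order lt (f x) \<le>o pred_order lt x" using i ordLeq_transitive by blast
      then show "pred_order lt (f x) =o pred_order lt x"
        using condensation_pred_order_le[OF T f x] ordIso_iff_ordLeq by blast
    qed
  next
    assume c: "\<forall>\<alpha> :: 'a rel. natLeq \<le>o \<alpha> \<and> \<alpha> <o height T lt \<longrightarrow>
        almost_constant (\<lambda>N. card N) (level_nodes T lt \<alpha>) \<or>
        finite_to_one (\<lambda>N. (card N, cardinal (upset T lt N))) (level_nodes T lt \<alpha>)"
    show "reversible T lt"
    proof (rule rev)
      fix f x assume f: "condensation T lt f" and x: "x \<in> T" and i: "natLeq \<le>o pred_order lt x"
        and below: "\<And>y. y \<in> T \<Longrightarrow> pred_order lt y <o pred_order lt x \<Longrightarrow>
          pred_order lt (f y) =o pred_order lt y"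
      have "f x \<in> level T lt (pred_order lt x)"
        using step[OF f x below] c i pred_order_less_height[OF T x] by blast
      then show "pred_order lt (f x) =o pred_order lt x" unfolding level_def by blast
    qed
  qed
qed

end
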